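(* Let $f:\{0,1\}^n\to\{0,1\}$ be a Boolean function and $B_1,\dots,B_k$ a partition of its input bits. For each $j$ let $D_j(f)$ denote the deterministic one-way communication complexity of $f$ when Alice receives all input bits not in $B_j$ and Bob receives the input bits in $B_j$. Then the size (number of leaves) of any formula computing $f$ consisting of arbitrary symmetric Boolean gates (of any fan-in) is at least $\sum_j D_j(f)/\log n$.
   Context: A Boolean formula is a Boolean circuit in which every gate has fan-out 1 (a tree); its size is its number of leaves. A gate is symmetric if its output depends only on the number of its inputs equal to 1. Deterministic one-way communication complexity: the minimal number of bits of a single message that Alice sends to Bob (depending on her input) after which Bob determines $f$ from the message and his input.
   Formalization: It is additionally assumed that f depends on at least one input bit in every block B_j and that n ≠ 3; without these the bound fails (f = x_1 with singleton blocks and n = 4; majority of 3 bits with singleton blocks). The logarithm is base 2. *)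

theory Defs
  imports Complex_Main "HOL-Library.Cardinality" "HOL-Library.Disjoint_Sets"
begin

text \<open>
  An input in \<open>{0,1}^n\<close> is a function \<open>'n \<Rightarrow> bool\<close> on a finite index type with \<open>n = CARD('n)\<close>.
\<close>

definition determined_by :: "(('n \<Rightarrow> bool) \<Rightarrow> 'a) \<Rightarrow> 'n set \<Rightarrow> bool" where
  "determined_by g S \<longleftrightarrow> (\<forall>x y. (\<forall>i\<in>S. x i = y i) \<longrightarrow> g x = g y)"

text \<open>
  In the protocol Alice holds the bits outside \<open>B\<close> and Bob holds those in \<open>B\<close>. Both
  parties' functions take a full input, and \<open>determined_by\<close> says which bits they may read.
  Every message has the same length, so \<open>c\<close> bits distinguish \<open>2 ^ c\<close> messages.
\<close>

definition one_way_protocol ::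
  "(('n \<Rightarrow> bool) \<Rightarrow> bool) \<Rightarrow> 'n set \<Rightarrow> nat \<Rightarrow>
   (('n \<Rightarrow> bool) \<Rightarrow> bool list) \<Rightarrow> (bool list \<Rightarrow> ('n \<Rightarrow> bool) \<Rightarrow> bool) \<Rightarrow> bool" where
  "one_way_protocol f B c alice bob \<longleftrightarrow>
     determined_by alice (- B) \<and> (\<forall>x. length (alice x) = c) \<and>
     (\<forall>m. determined_by (bob m) B) \<and>
     (\<forall>x. bob (alice x) x = f x)"

definition one_way_cc :: "(('n \<Rightarrow> bool) \<Rightarrow> bool) \<Rightarrow> 'n set \<Rightarrow> nat" where
  "one_way_cc f B = (LEAST c. \<exists>alice bob. one_way_protocol f B c alice bob)"

datatype 'n formula =
    Var 'n
  | Const bool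
  | Gate "bool list \<Rightarrow> bool" "'n formula list"

primrec eval :: "'n formula \<Rightarrow> ('n \<Rightarrow> bool) \<Rightarrow> bool" where
  "eval (Var i) x = x i"
| "eval (Const b) x = b"
| "eval (Gate g Fs) x = g (map (\<lambda>F. eval F x) Fs)"

primrec leaves :: "'n formula \<Rightarrow> nat" where
  "leaves (Var i) = 1"
| "leaves (Const b) = 1"
| "leaves (Gate g Fs) = sum_list (map leaves Fs)"

definition symmetric_gate :: "nat \<Rightarrow> (bool list \<Rightarrow> bool) \<Rightarrow> bool" where
  "symmetric_gate m g \<longleftrightarrow>
     (\<forall>xs ys. length xs = m \<and> length ys = m \<and> count_list xs True = count_list ys True
        \<longrightarrow> g xs = g ys)"

text \<open>
  Gates have at least one child, so that every childless node is counted by \<open>leaves\<close>.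
\<close>

fun symmetric_formula :: "'n formula \<Rightarrow> bool" where
  "symmetric_formula (Var i) \<longleftrightarrow> True"
| "symmetric_formula (Const b) \<longleftrightarrow> True"
| "symmetric_formula (Gate g Fs) \<longleftrightarrow>
     Fs \<noteq> [] \<and> symmetric_gate (length Fs) g \<and> (\<forall>F\<in>set Fs. symmetric_formula F)"

end

theory Submission
  imports Defs "HOL-Library.FuncSet"
begin

text \<open>
  Write \<open>l\<close> for the number of leaves with a variable in the block \<open>B\<close>; it suffices to bound the
  communication for each block by \<open>l log n\<close>. A gate with \<open>t\<close> children that read \<open>B\<close> sees them
  through a symmetric predicate on \<open>t\<close> bits, for which there are only \<open>2 ^ (t + 1)\<close>
  possibilities whatever the fan-in. Since only gates with \<open>t \<ge> 2\<close> create new subfunctions, their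
  number on \<open>B\<close> is at most \<open>24 ^ l / 8 + 1\<close>. This settles \<open>n \<ge> 24\<close>. For smaller \<open>n\<close> it is
  combined with the trivial bounds \<open>2 ^ (n - 1)\<close> and \<open>2 ^ 2 ^ l\<close>.
\<close>

section \<open>Subfunctions and one-way communication\<close>

text \<open>These are the distinct rows of the communication matrix: \<open>x\<close> supplies
  Alice's bits and \<open>y\<close> Bob's.\<close>

definition subfunctions ::
  "'n set \<Rightarrow> (('n \<Rightarrow> bool) \<Rightarrow> bool) \<Rightarrow> (('n \<Rightarrow> bool) \<Rightarrow> bool) set" where
  "subfunctions B f = range (\<lambda>x y. f (override_on x y B))"

text \<open>Alice sends a code of the row selected by her bits, and Bob evaluates that row on his
  own bits.\<close>

lemma one_way_cc_le:
  fixes f :: "('n::finite \<Rightarrow> bool) \<Rightarrow> bool"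
  assumes "card (subfunctions B f) \<le> 2 ^ c"
  shows "one_way_cc f B \<le> c"
proof -
  have card_msgs: "card {m::bool list. length m = c} = 2 ^ c"
    using card_lists_length_eq[of "UNIV::bool set" c] by simp
  then have "finite {m::bool list. length m = c}"
    by (simp add: card_ge_0_finite)
  then obtain enc where enc: "inj_on enc (subfunctions B f)"
      "enc ` subfunctions B f \<subseteq> {m::bool list. length m = c}"
    using inj_on_iff_card_le[of "subfunctions B f" "{m::bool list. length m = c}"]
      assms card_msgs by auto
  define alice where "alice x = enc (\<lambda>y. f (override_on x y B))" for x
  \<comment> \<open>Bob must ignore Alice's bits on every message, including strings that code
    nothing; the existential makes his answer \<open>False\<close> there.\<close>
  define bob where "bob m y \<longleftrightarrow> (\<exists>h\<in>subfunctions B f. enc h = m \<and> h y)" for m y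
  have mem: "(\<lambda>y. f (override_on x y B)) \<in> subfunctions B f" for x
    by (auto simp: subfunctions_def)
  have "determined_by alice (- B)"
    unfolding determined_by_def
  proof (intro allI impI)
    fix x x' :: "'n \<Rightarrow> bool"
    assume "\<forall>i\<in>- B. x i = x' i"
    then have "override_on x y B = override_on x' y B" for y
      by (auto simp: override_on_def)
    then show "alice x = alice x'" by (simp add: alice_def)
  qed
  moreover have "length (alice x) = c" for x
    using enc(2) mem[of x] by (auto simp: alice_def)
  moreover have "determined_by (bob m) B" for m
    unfolding determined_by_def
  proof (intro allI impI)
    fix y y' :: "'n \<Rightarrow> bool"
    assume "\<forall>i\<in>B. y i = y' i"
    then have "override_on x y B = override_on x y' B" for x
      by (auto simp: override_on_def)
    then have "h y = h y'" if "h \<in> subfunctions B f" for h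
      using that by (auto simp: subfunctions_def)
    then show "bob m y = bob m y'" by (auto simp: bob_def)
  qed
  moreover have "bob (alice x) x = f x" for x
  proof -
    have "bob (alice x) x \<longleftrightarrow> f (override_on x x B)"
      using enc(1) mem[of x] unfolding bob_def alice_def by (metis inj_onD)
    also have "override_on x x B = x" by (auto simp: override_on_def)
    finally show ?thesis .
  qed
  ultimately have "one_way_protocol f B c alice bob"
    by (simp add: one_way_protocol_def)
  then show ?thesis
    unfolding one_way_cc_def by (blast intro: Least_le)
qed

text \<open>A row depends only on which of Alice's bits are 1, and a nonempty block leaves her at
  most \<open>CARD('n) - 1\<close> bits.\<close>

lemma card_subfunctions_le_complement:
  fixes f :: "('n::finite \<Rightarrow> bool) \<Rightarrow> bool"
  assumes "B \<noteq> {}"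
  shows "card (subfunctions B f) \<le> 2 ^ (CARD('n) - 1)"
proof -
  have "subfunctions B f \<subseteq> (\<lambda>A y. f (override_on (\<lambda>i. i \<in> A) y B)) ` Pow (- B)"
  proof
    fix h assume "h \<in> subfunctions B f"
    then obtain x where h: "h = (\<lambda>y. f (override_on x y B))"
      by (auto simp: subfunctions_def)
    have "override_on x y B = override_on (\<lambda>i. i \<in> {i \<in> - B. x i}) y B" for y
      by (auto simp: override_on_def)
    then have "h = (\<lambda>A y. f (override_on (\<lambda>i. i \<in> A) y B)) {i \<in> - B. x i}"
      using h by simp
    then show "h \<in> (\<lambda>A y. f (override_on (\<lambda>i. i \<in> A) y B)) ` Pow (- B)"
      by (rule image_eqI) auto
  qed
  then have "card (subfunctions B f) \<le> card (Pow (- B))"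
    by (meson card_image_le card_mono finite finite_imageI le_trans)
  also have "\<dots> = 2 ^ (CARD('n) - card B)"
    by (simp add: card_Pow Compl_eq_Diff_UNIV card_Diff_subset)
  also have "\<dots> \<le> 2 ^ (CARD('n) - 1)"
    using assms by (intro power_increasing diff_le_mono2) (auto simp: Suc_le_eq card_gt_0_iff)
  finally show ?thesis .
qed

text \<open>A function is recovered from its truth table on \<open>V\<close>, stored as the family
  of subsets of \<open>V\<close> whose indicators it accepts.\<close>

lemma card_determined_by_le:
  fixes H :: "(('n::finite \<Rightarrow> bool) \<Rightarrow> bool) set"
  assumes "\<And>h. h \<in> H \<Longrightarrow> determined_by h V"
  shows "card H \<le> 2 ^ 2 ^ card V"
proof -
  define table where "table h = {A \<in> Pow V. h (\<lambda>i. i \<in> A)}" for h :: "('n \<Rightarrow> bool) \<Rightarrow> bool"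
  have "inj_on table H"
  proof (rule inj_onI)
    fix h h' assume hh: "h \<in> H" "h' \<in> H" and eq: "table h = table h'"
    show "h = h'"
    proof
      fix x :: "'n \<Rightarrow> bool"
      define A where "A = {i \<in> V. x i}"
      have agree: "\<forall>i\<in>V. x i = (i \<in> A)" by (auto simp: A_def)
      have "A \<in> table h \<longleftrightarrow> A \<in> table h'" using eq by simp
      then have "h (\<lambda>i. i \<in> A) = h' (\<lambda>i. i \<in> A)" by (auto simp: table_def A_def)
      moreover have "h x = h (\<lambda>i. i \<in> A)" "h' x = h' (\<lambda>i. i \<in> A)"
        using assms[OF hh(1)] assms[OF hh(2)] agree by (auto simp: determined_by_def)
      ultimately show "h x = h' x" by simp
    qed
  qed
  moreover have "table ` H \<subseteq> Pow (Pow V)" by (auto simp: table_def)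
  ultimately have "card H \<le> card (Pow (Pow V))"
    by (metis card_inj_on_le finite)
  then show ?thesis by (simp add: card_Pow)
qed

section \<open>Leaves inside a block\<close>

primrec leaves_in :: "'n set \<Rightarrow> 'n formula \<Rightarrow> nat" where
  "leaves_in B (Var i) = of_bool (i \<in> B)"
| "leaves_in B (Const b) = 0"
| "leaves_in B (Gate g Fs) = sum_list (map (leaves_in B) Fs)"

text \<open>Since blocks are disjoint, a variable leaf is charged to at most one of them, and a
  constant leaf to none.\<close>

lemma sum_leaves_in_le:
  assumes "disjoint P" "finite P"
  shows "(\<Sum>B\<in>P. leaves_in B F) \<le> leaves F"
proof (induction F)
  case (Var i)
  have "(\<Sum>B\<in>P. leaves_in B (Var i)) = card {B \<in> P. i \<in> B}"
    using assms(2) by (simp add: Int_def)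
  also have "\<dots> \<le> 1"
    using assms by (auto simp: card_le_Suc0_iff_eq disjoint_def)
  finally show ?case by simp
next
  case (Gate g Fs)
  have "(\<Sum>B\<in>P. sum_list (map (leaves_in B) Fs)) = sum_list (map (\<lambda>F. \<Sum>B\<in>P. leaves_in B F) Fs)"
    by (induction Fs) (auto simp: sum.distrib)
  also have "\<dots> \<le> sum_list (map leaves Fs)"
    using Gate by (intro sum_list_mono)
  finally show ?case by simp
qed simp

lemma eval_cong:
  assumes "\<And>i. i \<in> set_formula F \<Longrightarrow> x i = y i"
  shows "eval F x = eval F y"
  using assms
proof (induction F)
  case (Gate g Fs)
  then have "map (\<lambda>F. eval F x) Fs = map (\<lambda>F. eval F y) Fs" by auto
  then show ?case by (metis eval.simps(3))
qed auto

lemma card_vars_le_leaves_in: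
  fixes F :: "'n::finite formula"
  shows "card (B \<inter> set_formula F) \<le> leaves_in B F"
proof (induction F)
  case (Var i)
  then show ?case by (cases "i \<in> B") auto
next
  case (Gate g Fs)
  then show ?case
  proof (induction Fs)
    case (Cons F Fs)
    have "B \<inter> set_formula (Gate g (F # Fs))
        = (B \<inter> set_formula F) \<union> (B \<inter> set_formula (Gate g Fs))" by auto
    then have "card (B \<inter> set_formula (Gate g (F # Fs)))
        \<le> card (B \<inter> set_formula F) + card (B \<inter> set_formula (Gate g Fs))"
      by (metis card_Un_le)
    also have "\<dots> \<le> leaves_in B F + leaves_in B (Gate g Fs)"
      using Cons by (intro add_mono) auto
    finally show ?case by simp
  qed simp
qed simp

lemma leaves_in_0_disjoint:
  fixes F :: "'n::finite formula"
  assumes "leaves_in B F = 0"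
  shows "B \<inter> set_formula F = {}"
  using card_vars_le_leaves_in[of B F] assms by simp

lemma leaves_in_0_override:
  fixes F :: "'n::finite formula"
  assumes "leaves_in B F = 0"
  shows "eval F (override_on x y B) = eval F x"
  using leaves_in_0_disjoint[OF assms] by (intro eval_cong) (auto simp: override_on_def)

text \<open>Positivity is what makes a bound by leaves possible: a nonconstant function that ignores
  \<open>B\<close> still costs one bit, although a formula for it may have no leaf in
  \<open>B\<close>.\<close>

lemma leaves_in_pos:
  fixes F :: "'n::finite formula"
  assumes "\<not> determined_by (eval F) (- B)"
  shows "leaves_in B F > 0"
proof (rule ccontr)
  assume "\<not> leaves_in B F > 0"
  then have "B \<inter> set_formula F = {}" by (simp add: leaves_in_0_disjoint)
  then have "determined_by (eval F) (- B)"
    unfolding determined_by_def by (intro allI impI eval_cong) auto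
  with assms show False by simp
qed

text \<open>Few leaves in \<open>B\<close> means few variables read there, so truth tables can be
  counted. For two or three leaves this beats the gate count.\<close>

lemma card_subfunctions_le_double_exp:
  fixes F :: "'n::finite formula"
  shows "card (subfunctions B (eval F)) \<le> 2 ^ 2 ^ leaves_in B F"
proof -
  have "card (subfunctions B (eval F)) \<le> 2 ^ 2 ^ card (B \<inter> set_formula F)"
  proof (rule card_determined_by_le)
    fix h assume "h \<in> subfunctions B (eval F)"
    then obtain x where h: "h = (\<lambda>y. eval F (override_on x y B))"
      by (auto simp: subfunctions_def)
    show "determined_by h (B \<inter> set_formula F)"
      unfolding determined_by_def h
      by (intro allI impI eval_cong) (auto simp: override_on_def)
  qed
  also have "\<dots> \<le> 2 ^ 2 ^ leaves_in B F"
    using card_vars_le_leaves_in[of B F] by (intro power_increasing) auto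
  finally show ?thesis .
qed

section \<open>Counting the subfunctions of a symmetric formula\<close>

text \<open>
  Closing under complement and constants makes the family of subfunctions stable under gates
  with a single child that reads \<open>B\<close>. The constant \<open>True\<close> is left out because inside the count
  of a symmetric gate it acts as \<open>False\<close> together with a shift.
\<close>

definition closed_subfunctions ::
  "'n set \<Rightarrow> (('n \<Rightarrow> bool) \<Rightarrow> bool) \<Rightarrow> (('n \<Rightarrow> bool) \<Rightarrow> bool) set" where
  "closed_subfunctions B f =
     {h. h = (\<lambda>_. False) \<or> h \<in> subfunctions B f \<or> (\<lambda>y. \<not> h y) \<in> subfunctions B f} - {\<lambda>_. True}"

lemma card_subfunctions_le_closed:
  fixes f :: "('n::finite \<Rightarrow> bool) \<Rightarrow> bool"
  shows "card (subfunctions B f) \<le> card (closed_subfunctions B f) + 1"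
proof -
  have "card (subfunctions B f) \<le> card (insert (\<lambda>_. True) (closed_subfunctions B f))"
    by (intro card_mono) (auto simp: closed_subfunctions_def)
  also have "\<dots> \<le> card (closed_subfunctions B f) + 1"
    by (simp add: card_insert_le_m1 card_insert_if)
  finally show ?thesis .
qed

text \<open>Used with families \<open>E\<close> built from the children of a gate, so that
  complements need no separate analysis of the gate.\<close>

lemma closed_subfunctions_subset:
  assumes "subfunctions B f \<subseteq> E" "(\<lambda>_. False) \<in> E" "\<And>h. h \<in> E \<Longrightarrow> (\<lambda>y. \<not> h y) \<in> E"
  shows "closed_subfunctions B f \<subseteq> E"
proof
  fix h assume "h \<in> closed_subfunctions B f"
  then consider "h = (\<lambda>_. False)" | "h \<in> subfunctions B f" | "(\<lambda>y. \<not> h y) \<in> subfunctions B f"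
    by (auto simp: closed_subfunctions_def)
  then show "h \<in> E"
  proof cases
    case 3
    then have "(\<lambda>y. \<not> \<not> h y) \<in> E" using assms(1,3) by blast
    then show ?thesis by simp
  qed (use assms in auto)
qed

lemma symmetric_gateE:
  assumes "symmetric_gate m g"
  obtains \<psi> where "\<And>xs. length xs = m \<Longrightarrow> g xs = \<psi> (count_list xs True)"
proof
  fix xs :: "bool list" assume "length xs = m"
  then show "g xs = (\<lambda>k. \<exists>ys. length ys = m \<and> count_list ys True = k \<and> g ys) (count_list xs True)"
    using assms unfolding symmetric_gate_def by metis
qed

lemma count_list_True_conv_sum:
  "count_list (map p xs) True = (\<Sum>i<length xs. of_bool (p (xs ! i)))"
  by (induction xs) (auto simp: sum.lessThan_Suc_shift simp del: sum.lessThan_Suc sum_of_bool_eq)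

text \<open>
  The children without leaves in \<open>B\<close> only contribute an offset to the count, so the gate sees
  \<open>B\<close> through one of the finitely many sets \<open>A\<close> of accepted counts.
\<close>

lemma gate_subfunction:
  fixes Fs :: "'n::finite formula list" and B :: "'n set"
  defines "J \<equiv> {i. i < length Fs \<and> leaves_in B (Fs ! i) > 0}"
  assumes sym: "symmetric_gate (length Fs) g" and h: "h \<in> subfunctions B (eval (Gate g Fs))"
  obtains A r where "A \<subseteq> {..card J}"
    "r \<in> (\<Pi>\<^sub>E i\<in>J. closed_subfunctions B (eval (Fs ! i)))"
    "h = (\<lambda>y. (\<Sum>i\<in>J. of_bool (r i y)) \<in> A)"
proof -
  obtain x where hx: "h = (\<lambda>y. eval (Gate g Fs) (override_on x y B))"
    using h by (auto simp: subfunctions_def)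
  obtain \<psi> where \<psi>: "\<And>xs. length xs = length Fs \<Longrightarrow> g xs = \<psi> (count_list xs True)"
    using sym by (rule symmetric_gateE) blast
  define s where "s i = (\<lambda>y. eval (Fs ! i) (override_on x y B))" for i
  \<comment> \<open>A child frozen to \<open>True\<close> is replaced by \<open>False\<close>. The
    offset \<open>c\<close> makes up for it: it counts these children, and the true ones among those
    without leaves in \<open>B\<close>.\<close>
  define r where "r = restrict (\<lambda>i. if s i = (\<lambda>_. True) then (\<lambda>_. False) else s i) J"
  define K where "K = {..<length Fs} - J"
  define c :: nat where "c = (\<Sum>i\<in>K. of_bool (eval (Fs ! i) x)) + (\<Sum>i\<in>J. of_bool (s i = (\<lambda>_. True)))"
  define N where "N y = (\<Sum>i\<in>J. of_bool (r i y) :: nat)" for y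
  have fin: "finite J" by (simp add: J_def)
  have J: "J \<subseteq> {..<length Fs}" by (auto simp: J_def)
  have count: "count_list (map (\<lambda>F. eval F (override_on x y B)) Fs) True = c + N y" for y
  proof -
    have "count_list (map (\<lambda>F. eval F (override_on x y B)) Fs) True
        = (\<Sum>i<length Fs. of_bool (s i y))"
      by (simp add: count_list_True_conv_sum s_def)
    also have "\<dots> = (\<Sum>i\<in>K. of_bool (s i y)) + (\<Sum>i\<in>J. of_bool (s i y))"
      using J unfolding K_def by (intro sum.subset_diff) auto
    also have "(\<Sum>i\<in>K. of_bool (s i y)) = (\<Sum>i\<in>K. of_bool (eval (Fs ! i) x) :: nat)"
      by (intro sum.cong) (auto simp: K_def J_def s_def leaves_in_0_override)
    also have "(\<Sum>i\<in>J. of_bool (s i y))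
        = (\<Sum>i\<in>J. of_bool (s i = (\<lambda>_. True)) + of_bool (r i y) :: nat)"
      by (intro sum.cong) (auto simp: r_def)
    finally show ?thesis by (simp add: c_def N_def sum.distrib)
  qed
  show thesis
  proof
    \<comment> \<open>The accepted counts of the gate, shifted by \<open>c\<close> and cut off at
      the largest value that \<open>N\<close> can take.\<close>
    show "{k. k \<le> card J \<and> \<psi> (c + k)} \<subseteq> {..card J}" by auto
    have "r i \<in> closed_subfunctions B (eval (Fs ! i))" if "i \<in> J" for i
    proof (cases "s i = (\<lambda>_. True)")
      case True
      with that show ?thesis by (auto simp: r_def closed_subfunctions_def fun_eq_iff)
    next
      case False
      moreover have "s i \<in> subfunctions B (eval (Fs ! i))"
        by (auto simp: s_def subfunctions_def)
      ultimately show ?thesis using that by (auto simp: r_def closed_subfunctions_def)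
    qed
    then show "r \<in> (\<Pi>\<^sub>E i\<in>J. closed_subfunctions B (eval (Fs ! i)))"
      by (auto simp: r_def)
    have "N y \<le> card J" for y
      unfolding N_def using sum_bounded_above[of J "\<lambda>i. of_bool (r i y)" "1::nat"] by simp
    then show "h = (\<lambda>y. (\<Sum>i\<in>J. of_bool (r i y)) \<in> {k. k \<le> card J \<and> \<psi> (c + k)})"
      unfolding hx N_def[symmetric] by (auto simp: \<psi> count)
  qed
qed

text \<open>The factor 8 makes the bound multiplicative over children: with \<open>t\<close>
  children having leaves in \<open>B\<close>, \<open>8 * 2 ^ (t + 1) \<le> 8 ^ t\<close> holds from
  \<open>t = 2\<close> on, with equality there. A variable leaf contributes three functions, hence
  the base \<open>24 = 8 * 3\<close>.\<close>

lemma card_closed_subfunctions_le: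
  fixes F :: "'n::finite formula"
  assumes "symmetric_formula F" "leaves_in B F > 0"
  shows "8 * card (closed_subfunctions B (eval F)) \<le> 24 ^ leaves_in B F"
  using assms
proof (induction F)
  case (Var i)
  then have "i \<in> B" by (simp split: if_splits)
  have "closed_subfunctions B (eval (Var i)) \<subseteq> {\<lambda>_. False, \<lambda>_. True, \<lambda>y. y i, \<lambda>y. \<not> y i}"
    using \<open>i \<in> B\<close> by (intro closed_subfunctions_subset) (auto simp: subfunctions_def override_on_def)
  then have "closed_subfunctions B (eval (Var i)) \<subseteq> {\<lambda>_. False, \<lambda>y. y i, \<lambda>y. \<not> y i}"
    unfolding closed_subfunctions_def by blast
  then have "card (closed_subfunctions B (eval (Var i))) \<le> card {\<lambda>_. False, \<lambda>y. y i, \<lambda>y::'n \<Rightarrow> bool. \<not> y i}"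
    by (intro card_mono) auto
  also have "\<dots> \<le> 3" by (simp add: card_insert_if)
  finally show ?case using \<open>i \<in> B\<close> by (simp del: eval.simps)
next
  case (Const b)
  then show ?case by simp
next
  case (Gate g Fs)
  define J where "J = {i. i < length Fs \<and> leaves_in B (Fs ! i) > 0}"
  define R where "R i = closed_subfunctions B (eval (Fs ! i))" for i
  let ?l = "\<lambda>i. leaves_in B (Fs ! i)"
  have fin: "finite J" by (simp add: J_def)
  have IH: "8 * card (R i) \<le> 24 ^ ?l i" if "i \<in> J" for i
    using that Gate by (auto simp: J_def R_def)
  have "leaves_in B (Gate g Fs) = (\<Sum>i<length Fs. ?l i)"
    by (simp add: sum_list_sum_nth atLeast0LessThan)
  also have "\<dots> = (\<Sum>i\<in>J. ?l i)"
    by (intro sum.mono_neutral_right) (auto simp: J_def)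
  finally have l: "leaves_in B (Gate g Fs) = (\<Sum>i\<in>J. ?l i)" .
  with Gate.prems have "J \<noteq> {}" by auto
  have sym: "symmetric_gate (length Fs) g" using Gate.prems by simp
  show ?case
  proof (cases "card J = 1")
    case True
    then obtain j where j: "J = {j}" by (auto simp: card_1_singleton_iff)
    have "closed_subfunctions B (eval (Gate g Fs)) \<subseteq> insert (\<lambda>_. True) (R j)"
    proof (rule closed_subfunctions_subset)
      show neg: "(\<lambda>y. \<not> h y) \<in> insert (\<lambda>_. True) (R j)" if "h \<in> insert (\<lambda>_. True) (R j)" for h
        using that by (auto simp: R_def closed_subfunctions_def)
      show False_R: "(\<lambda>_. False) \<in> insert (\<lambda>_. True) (R j)"
        by (auto simp: R_def closed_subfunctions_def fun_eq_iff)
      show "subfunctions B (eval (Gate g Fs)) \<subseteq> insert (\<lambda>_. True) (R j)"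
      proof
        fix h assume "h \<in> subfunctions B (eval (Gate g Fs))"
        then obtain A r where
          r: "r \<in> Pi\<^sub>E J R" and h: "h = (\<lambda>y. (\<Sum>i\<in>J. of_bool (r i y)) \<in> (A :: nat set))"
          by (rule gate_subfunction[OF sym, where B = B, folded J_def R_def])
        have rj: "r j \<in> R j" using r j by auto
        \<comment> \<open>Only the counts 0 and 1 occur, so the gate applies one of the four unary
          Boolean functions to \<open>r j\<close>. Up to the constant \<open>True\<close>, each
          result stays in \<open>R j\<close>.\<close>
        have "h = (\<lambda>y. if r j y then 1 \<in> A else 0 \<in> A)"
          using h j by (auto simp del: sum_of_bool_eq)
        then consider "h = (\<lambda>_. True)" | "h = (\<lambda>_. False)" | "h = r j" | "h = (\<lambda>y. \<not> r j y)"
          by (cases "0 \<in> A"; cases "1 \<in> A") auto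
        then show "h \<in> insert (\<lambda>_. True) (R j)"
          using False_R rj neg[of "r j"] by cases auto
      qed
    qed
    then have "closed_subfunctions B (eval (Gate g Fs)) \<subseteq> R j"
      by (auto simp: closed_subfunctions_def)
    then have "card (closed_subfunctions B (eval (Gate g Fs))) \<le> card (R j)"
      by (intro card_mono) auto
    then show ?thesis using IH[of j] l j by (simp del: eval.simps leaves_in.simps)
  next
    case False
    with \<open>J \<noteq> {}\<close> fin have "card J \<ge> 2"
      by (metis One_nat_def Suc_1 card_0_eq less_2_cases_iff not_less)
    \<comment> \<open>A choice of accepted counts and of one closed subfunction per child: at most
      \<open>2 ^ (card J + 1)\<close> times a product.\<close>
    define E where "E = (\<lambda>(A, r) y. (\<Sum>i\<in>J. of_bool (r i y) :: nat) \<in> A) ` (Pow {..card J} \<times> Pi\<^sub>E J R)"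
    have bound: "(\<Sum>i\<in>J. of_bool (r i y) :: nat) \<le> card J" for r :: "nat \<Rightarrow> ('n \<Rightarrow> bool) \<Rightarrow> bool" and y
      using sum_bounded_above[of J "\<lambda>i. of_bool (r i y)" "1::nat"] by simp
    have "closed_subfunctions B (eval (Gate g Fs)) \<subseteq> E"
    proof (rule closed_subfunctions_subset)
      show "subfunctions B (eval (Gate g Fs)) \<subseteq> E"
      proof
        fix h assume "h \<in> subfunctions B (eval (Gate g Fs))"
        then obtain A r where "A \<subseteq> {..card J}" "r \<in> Pi\<^sub>E J R"
            "h = (\<lambda>y. (\<Sum>i\<in>J. of_bool (r i y)) \<in> A)"
          by (rule gate_subfunction[OF sym, where B = B, folded J_def R_def])
        then show "h \<in> E"
          unfolding E_def by (intro image_eqI[of _ _ "(A, r)"]) auto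
      qed
      show "(\<lambda>_. False) \<in> E"
        unfolding E_def
        by (rule image_eqI[of _ _ "({}, restrict (\<lambda>i _. False) J)"])
          (auto simp: R_def closed_subfunctions_def fun_eq_iff)
      show "(\<lambda>y. \<not> h y) \<in> E" if "h \<in> E" for h
      proof -
        from that obtain A r where r: "r \<in> Pi\<^sub>E J R"
            and h: "h = (\<lambda>y. (\<Sum>i\<in>J. of_bool (r i y)) \<in> (A :: nat set))"
          by (auto simp: E_def)
        \<comment> \<open>Complementing \<open>A\<close> within \<open>{..card J}\<close> negates
          the function, because no count exceeds \<open>card J\<close>.\<close>
        show ?thesis
          unfolding E_def using r bound[of r]
          by (intro image_eqI[of _ _ "({..card J} - A, r)"]) (auto simp: h)
      qed
    qed
    then have "card (closed_subfunctions B (eval (Gate g Fs))) \<le> card E"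
      by (intro card_mono) auto
    also have "\<dots> \<le> card (Pow {..card J} \<times> Pi\<^sub>E J R)"
      unfolding E_def using fin by (intro card_image_le finite_cartesian_product finite_PiE) auto
    also have "\<dots> = 2 * 2 ^ card J * (\<Prod>i\<in>J. card (R i))"
      by (simp add: card_cartesian_product card_Pow card_PiE fin)
    finally have "8 * card (closed_subfunctions B (eval (Gate g Fs)))
        \<le> 16 * 2 ^ card J * (\<Prod>i\<in>J. card (R i))" by (simp add: mult.commute)
    also have "\<dots> \<le> 4 ^ card J * 2 ^ card J * (\<Prod>i\<in>J. card (R i))"
      using power_increasing[OF \<open>card J \<ge> 2\<close>, of "4::nat"] by (intro mult_right_mono) auto
    also have "\<dots> = (\<Prod>i\<in>J. 8 * card (R i))"
      by (simp add: prod.distrib flip: power_mult_distrib)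
    also have "\<dots> \<le> (\<Prod>i\<in>J. 24 ^ ?l i)"
      using IH by (intro prod_mono) auto
    also have "\<dots> = 24 ^ leaves_in B (Gate g Fs)"
      unfolding l by (simp add: power_sum)
    finally show ?thesis .
  qed
qed

section \<open>Fitting a power of two below \<open>n ^ l\<close>\<close>

text \<open>Messages have a whole number of bits, so \<open>N \<le> n ^ l\<close> is not enough: a
  power of two must lie in between. For \<open>n = 3\<close> and \<open>l = 1\<close>, the value
  \<open>N = 4\<close> passes all three bounds yet exceeds \<open>n ^ l\<close>.\<close>

lemma exponent_between:
  fixes n l N :: nat
  assumes n: "n \<ge> 2" "n \<noteq> 3" and l: "l > 0"
    and few_inputs: "N \<le> 2 ^ (n - 1)" and few_variables: "N \<le> 2 ^ 2 ^ l"
    and formula_count: "8 * N \<le> 24 ^ l + 8"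
  shows "\<exists>c. N \<le> 2 ^ c \<and> 2 ^ c \<le> n ^ l"
proof -
  have by_inputs: ?thesis if "2 ^ (n - 1) \<le> n ^ l"
    using few_inputs that by blast
  have mono_l: "n ^ k \<le> n ^ l" if "k \<le> l" for k
    using that n by (intro power_increasing) auto
  have mono_n: "k ^ l \<le> n ^ l" if "k \<le> n" for k
    using that by (intro power_mono) auto
  \<comment> \<open>The ranges are cut so that in each of them one of the three bounds
    suffices.\<close>
  have "n = 2 \<or> 4 \<le> n \<and> n \<le> 6 \<or> 7 \<le> n \<and> n \<le> 15 \<or> 16 \<le> n \<and> n \<le> 23 \<or> n \<ge> 24"
      "l \<le> 2 \<or> l = 3 \<or> 4 \<le> l \<and> l \<le> 5 \<or> l \<ge> 6"
    using n by linarith+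
  then consider "n = 2" | "4 \<le> n" "l \<le> 2" | "4 \<le> n" "n \<le> 6" "l = 3" | "7 \<le> n" "n \<le> 15" "l = 3"
    | "4 \<le> n" "n \<le> 15" "l \<ge> 4" | "16 \<le> n" "n \<le> 23" "3 \<le> l" "l \<le> 5" | "16 \<le> n" "n \<le> 23" "l \<ge> 6"
    | "n \<ge> 24"
    by (elim disjE conjE) simp_all
  then show ?thesis
  proof cases
    case 1
    then show ?thesis using by_inputs mono_l[of 1] l by simp
  next
    case 2
    \<comment> \<open>For one or two leaves the truth table bound is exactly the power of two
      \<open>4 ^ l\<close>.\<close>
    then have "l = 1 \<or> l = 2" using l by auto
    then have "(2::nat) ^ 2 ^ l = 4 ^ l" by auto
    then show ?thesis using few_variables mono_n[of 4] 2 by metis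
  next
    case 3
    then have "n \<in> {4, 5, 6}" by auto
    then show ?thesis using by_inputs 3 by auto
  next
    case 4
    \<comment> \<open>Truth tables give 256, which fits below \<open>7 ^ 3 = 343\<close> but not
      below \<open>6 ^ 3 = 216\<close>; hence the input bound in the previous case.\<close>
    then have "(2::nat) ^ 2 ^ l \<le> 7 ^ l" by simp
    then show ?thesis using few_variables mono_n[of 7] 4 le_trans by metis
  next
    case 5
    then have "n = 4 \<or> n = 5 \<or> n = 6 \<or> n = 7 \<or> n = 8 \<or> n = 9 \<or> n = 10 \<or> n = 11 \<or> n = 12
        \<or> n = 13 \<or> n = 14 \<or> n = 15" by presburger
    then have "2 ^ (n - 1) \<le> n ^ 4" by (elim disjE) simp_all
    then show ?thesis using by_inputs mono_l[OF 5(3)] le_trans by blast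
  next
    case 6
    then have "l \<in> {3, 4, 5}" by auto
    \<comment> \<open>The power of two \<open>16 ^ l\<close> has room for the gate count only up to
      \<open>l = 5\<close>, since \<open>(3 / 2) ^ 6 > 8\<close>.\<close>
    then have "24 ^ l + 8 \<le> 8 * (16::nat) ^ l" by auto
    then have "N \<le> 16 ^ l" using formula_count by linarith
    moreover have "(16::nat) ^ l = 2 ^ (4 * l)" by (simp add: power_mult)
    ultimately show ?thesis using mono_n[of 16] 6 by metis
  next
    case 7
    \<comment> \<open>From here on the input bound fits below \<open>16 ^ l\<close>, as
      \<open>n - 1 \<le> 22\<close> and \<open>4 * l \<ge> 24\<close>.\<close>
    then have "(2::nat) ^ (n - 1) \<le> 2 ^ (4 * l)" by (intro power_increasing) auto
    also have "\<dots> = 16 ^ l" by (simp add: power_mult)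
    also have "\<dots> \<le> n ^ l" using mono_n 7 by simp
    finally show ?thesis by (rule by_inputs)
  next
    case 8
    \<comment> \<open>Rounding \<open>24 ^ l\<close> down to a power of two loses less than a factor
      2, which the factor 8 in \<open>formula_count\<close> absorbs.\<close>
    obtain c where c: "2 ^ c \<le> (24::nat) ^ l" "24 ^ l < (2::nat) ^ (c + 1)"
      using ex_power_ivl1[of 2 "24 ^ l"] by auto
    have "(24::nat) ^ 1 \<le> 24 ^ l" using l by (intro power_increasing) auto
    then have "N \<le> 2 ^ c" using c(2) formula_count by simp
    then show ?thesis using c(1) mono_n[of 24] 8 le_trans by blast
  qed
qed

section \<open>From a single block to the whole partition\<close>

lemma one_way_cc_le_leaves_in:
  fixes F :: "'n::finite formula"
  assumes "symmetric_formula F" "\<not> determined_by (eval F) (- B)" "CARD('n) \<ge> 2" "CARD('n) \<noteq> 3"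
  shows "real (one_way_cc (eval F) B) \<le> real (leaves_in B F) * log 2 (real CARD('n))"
proof -
  have l: "leaves_in B F > 0" using assms(2) by (rule leaves_in_pos)
  \<comment> \<open>An empty block leaves all bits with Alice, and these determine any
    function.\<close>
  then have "B \<noteq> {}" using assms(2) by (auto simp: determined_by_def fun_eq_iff[symmetric])
  have "8 * card (subfunctions B (eval F)) \<le> 24 ^ leaves_in B F + 8"
    using card_closed_subfunctions_le[OF assms(1) l] card_subfunctions_le_closed[of B "eval F"]
    by linarith
  then obtain c where c: "card (subfunctions B (eval F)) \<le> 2 ^ c" "2 ^ c \<le> CARD('n) ^ leaves_in B F"
    using exponent_between[OF assms(3,4) l card_subfunctions_le_complement[OF \<open>B \<noteq> {}\<close>]
      card_subfunctions_le_double_exp] by blast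
  have c': "(2::real) ^ c \<le> real CARD('n) ^ leaves_in B F"
    using of_nat_mono[OF c(2), where 'a = real] by simp
  have "real (one_way_cc (eval F) B) \<le> real c"
    using one_way_cc_le[OF c(1)] by simp
  also have "\<dots> = log 2 (2 ^ c)" by simp
  also have "\<dots> \<le> log 2 (real CARD('n) ^ leaves_in B F)"
    using c' by (intro log_mono) auto
  also have "\<dots> = real (leaves_in B F) * log 2 (real CARD('n))"
    using assms(3) by (simp add: log_nat_power)
  finally show ?thesis .
qed

theorem theorem6:
  fixes f :: "('n::finite \<Rightarrow> bool) \<Rightarrow> bool"
    and P :: "'n set set"
    and F :: "'n formula"
  assumes "partition_on UNIV P"
    and "\<forall>B\<in>P. \<not> determined_by f (- B)"
    and "CARD('n) \<noteq> 3"
    and "symmetric_formula F"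
    and "\<forall>x. eval F x = f x"
  shows "real (leaves F) \<ge> (\<Sum>B\<in>P. real (one_way_cc f B)) / log 2 (real CARD('n))"
proof (cases "CARD('n) = 1")
  case True
  \<comment> \<open>Here \<open>log 2 1 = 0\<close>, and division by zero yields 0.\<close>
  then show ?thesis by simp
next
  case False
  then have n: "CARD('n) \<ge> 2"
    using zero_less_card_finite[where 'a = 'n] by linarith
  have f: "f = eval F" using assms(5) by auto
  have "(\<Sum>B\<in>P. real (one_way_cc f B)) \<le> (\<Sum>B\<in>P. real (leaves_in B F) * log 2 (real CARD('n)))"
    unfolding f using assms(2-4) n f by (intro sum_mono one_way_cc_le_leaves_in) auto
  also have "\<dots> = real (\<Sum>B\<in>P. leaves_in B F) * log 2 (real CARD('n))"
    by (simp add: sum_distrib_right)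
  also have "\<dots> \<le> real (leaves F) * log 2 (real CARD('n))"
    using assms(1) n by (intro mult_right_mono of_nat_mono sum_leaves_in_le)
      (auto simp: partition_on_def)
  finally show ?thesis
    using n by (simp add: divide_le_eq)
qed

end
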